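(* Let $\mathfrak{alt}$ be the six-dimensional real Lie algebra with basis $V_+, D, Y_{-1/2}, X_1, Y_{1/2}, M_0$ described in the context. Then: (1) $\mathfrak{alt}\simeq \mathfrak{sl}(2,\mathbb{R})\otimes \mathbb{R}[\varepsilon]/\varepsilon^2$ as real Lie algebras, where $\varepsilon$ is a formal variable with $\varepsilon^2=0$; (2) $\mathfrak{alt}\simeq \mathfrak{p}_3$ as real Lie algebras, where $\mathfrak{p}_3\simeq\mathfrak{so}(2,1)\ltimes\mathbb{R}^3$ is the relativistic Poincaré algebra in $(2+1)$ dimensions.
   Context: The Lie algebra $\mathfrak{alt}$ is one of the maximal parabolic subalgebras of the conformal algebra $\mathfrak{conf}_3$ (isomorphic to $\mathfrak{so}(3,2)$ in its real form acting here), realized as conformal vector fields on $\mathbb{R}^3$ with coordinates $(t,r,\zeta)$ and metric given by the quadratic form $r^2-2t\zeta$. Explicitly, $\mathfrak{alt}$ is the real span of the vector fields $$V_+=-2tr\,\partial_t-(r^2+2t\zeta)\,\partial_r-2\zeta r\,\partial_\zeta,\quad D=-t\,\partial_t-r\,\partial_r-\zeta\,\partial_\zeta,\quad Y_{-1/2}=-\partial_r,$$ $$X_1=-t^2\,\partial_t-tr\,\partial_r-\tfrac12 r^2\,\partial_\zeta,\quad Y_{1/2}=-t\,\partial_r-r\,\partial_\zeta,\quad M_0=-\partial_\zeta,$$ with the commutator of vector fields as Lie bracket. The Lie algebra $\mathfrak{sl}(2,\mathbb{R})\otimes\mathbb{R}[\varepsilon]/\varepsilon^2$ carries the bracket $[X\otimes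 a,Y\otimes b]=[X,Y]\otimes ab$. In $\mathfrak{so}(2,1)\ltimes\mathbb{R}^3$, $\mathbb{R}^3$ is an abelian ideal on which $\mathfrak{so}(2,1)$ acts by its standard (vector) representation. *)

theory Defs
  imports
    "HOL-Analysis.Analysis"
    "HOL-Analysis.Finite_Function_Topology"
    "HOL-Library.Function_Algebras"
    "HOL-Computational_Algebra.Polynomial"
begin

section \<open>Real Lie algebras\<close>

class real_lie_algebra = real_vector +
  fixes lie_bracket :: "'a \<Rightarrow> 'a \<Rightarrow> 'a"
  assumes lie_bracket_add_left: "lie_bracket (x + y) z = lie_bracket x z + lie_bracket y z"
    and lie_bracket_add_right: "lie_bracket x (y + z) = lie_bracket x y + lie_bracket x z"
    and lie_bracket_scaleR_left: "lie_bracket (c *\<^sub>R x) y = c *\<^sub>R lie_bracket x y"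
    and lie_bracket_scaleR_right: "lie_bracket x (c *\<^sub>R y) = c *\<^sub>R lie_bracket x y"
    and lie_bracket_self: "lie_bracket x x = 0"
    and lie_bracket_jacobi:
      "lie_bracket x (lie_bracket y z) + lie_bracket y (lie_bracket z x)
         + lie_bracket z (lie_bracket x y) = 0"

lemma lie_bracket_antisym: "lie_bracket x y + lie_bracket y x = (0 :: 'a::real_lie_algebra)"
proof -
  have "0 = lie_bracket (x + y) (x + y)" by (simp only: lie_bracket_self)
  also have "\<dots> = lie_bracket x y + lie_bracket y x"
    unfolding lie_bracket_add_left lie_bracket_add_right by (simp add: lie_bracket_self)
  finally show ?thesis by (rule sym)
qed

definition lie_isomorphism :: "('a::real_lie_algebra \<Rightarrow> 'b::real_lie_algebra) \<Rightarrow> bool" where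
  "lie_isomorphism f \<longleftrightarrow>
     linear f \<and> bij f \<and> (\<forall>x y. f (lie_bracket x y) = lie_bracket (f x) (f y))"

definition matrix_commutator :: "real^'n^'n \<Rightarrow> real^'n^'n \<Rightarrow> real^'n^'n" where
  "matrix_commutator A B = A ** B - B ** A"

lemma matrix_mult_uminus_left: "(- A) ** B = - (A ** (B :: real^'n^'n))"
  by (simp add: matrix_matrix_mult_def vec_eq_iff sum_negf)

lemma matrix_mult_uminus_right: "A ** (- B) = - (A ** (B :: real^'n^'n))"
  by (simp add: matrix_matrix_mult_def vec_eq_iff sum_negf)

lemma matrix_mult_diff_left: "(A - B) ** C = A ** C - B ** (C :: real^'n^'n)"
  by (simp add: matrix_matrix_mult_def vec_eq_iff left_diff_distrib sum_subtractf)

lemma matrix_mult_diff_right: "A ** (B - C) = A ** B - A ** (C :: real^'n^'n)"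
  by (simp add: matrix_matrix_mult_def vec_eq_iff right_diff_distrib sum_subtractf)

lemma matrix_mult_scaleR_left: "(c *\<^sub>R A) ** B = c *\<^sub>R (A ** (B :: real^'n^'n))"
  by (simp add: matrix_matrix_mult_def vec_eq_iff sum_distrib_left mult.assoc)

lemma matrix_mult_scaleR_right: "A ** (c *\<^sub>R B) = c *\<^sub>R (A ** (B :: real^'n^'n))"
  by (simp add: matrix_matrix_mult_def vec_eq_iff sum_distrib_left mult.left_commute)

lemma matrix_mult_add_left: "(A + B) ** C = A ** C + B ** (C :: real^'n^'n)"
  by (simp add: matrix_matrix_mult_def vec_eq_iff distrib_right sum.distrib)

lemmas matrix_commutator_algebra =
  matrix_mult_add_left matrix_add_ldistrib matrix_mult_diff_left matrix_mult_diff_right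
  matrix_mult_scaleR_left matrix_mult_scaleR_right matrix_mult_uminus_left
  matrix_mult_uminus_right matrix_mul_assoc

lemma matrix_commutator_jacobi:
  "matrix_commutator A (matrix_commutator B C) + matrix_commutator B (matrix_commutator C A)
     + matrix_commutator C (matrix_commutator A B) = 0"
  by (simp add: matrix_commutator_def matrix_commutator_algebra)

section \<open>The Lie algebra \<open>alt\<close> of conformal vector fields\<close>

instantiation "fun" :: (type, real_vector) real_vector
begin

definition scaleR_fun :: "real \<Rightarrow> ('a \<Rightarrow> 'b) \<Rightarrow> 'a \<Rightarrow> 'b" where
  "scaleR_fun c f = (\<lambda>x. c *\<^sub>R f x)"

instance
  by standard (auto simp: scaleR_fun_def fun_eq_iff scaleR_add_right scaleR_add_left)

end

text \<open>
  A vector field on \<open>\<real>\<^sup>3\<close> is represented by its component function; the coordinates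
  \<open>x $ 1\<close>, \<open>x $ 2\<close>, \<open>x $ 3\<close> are \<open>t\<close>, \<open>r\<close>, \<open>\<zeta>\<close>. The bracket is the commutator
  of derivations: the \<open>i\<close>-th component of \<open>[X,Y]\<close> is \<open>X(Y\<^sub>i) - Y(X\<^sub>i)\<close>.
\<close>

definition vf_bracket ::
  "(real^3 \<Rightarrow> real^3) \<Rightarrow> (real^3 \<Rightarrow> real^3) \<Rightarrow> real^3 \<Rightarrow> real^3" where
  "vf_bracket X Y =
     (\<lambda>x. frechet_derivative Y (at x) (X x) - frechet_derivative X (at x) (Y x))"

definition V_plus :: "real^3 \<Rightarrow> real^3" where
  "V_plus = (\<lambda>x. let t = x $ 1; r = x $ 2; \<zeta> = x $ 3 in
     vector [- 2 * t * r, - (r\<^sup>2 + 2 * t * \<zeta>), - 2 * \<zeta> * r])"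

definition D_field :: "real^3 \<Rightarrow> real^3" where
  "D_field = (\<lambda>x. let t = x $ 1; r = x $ 2; \<zeta> = x $ 3 in vector [- t, - r, - \<zeta>])"

definition Y_minus_half :: "real^3 \<Rightarrow> real^3" where
  "Y_minus_half = (\<lambda>x. vector [0, - 1, 0])"

definition X_one :: "real^3 \<Rightarrow> real^3" where
  "X_one = (\<lambda>x. let t = x $ 1; r = x $ 2 in vector [- t\<^sup>2, - t * r, - (1 / 2) * r\<^sup>2])"

definition Y_half :: "real^3 \<Rightarrow> real^3" where
  "Y_half = (\<lambda>x. let t = x $ 1; r = x $ 2 in vector [0, - t, - r])"

definition M_zero :: "real^3 \<Rightarrow> real^3" where
  "M_zero = (\<lambda>x. vector [0, 0, - 1])"

definition alt_basis :: "(real^3 \<Rightarrow> real^3) set" where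
  "alt_basis = {V_plus, D_field, Y_minus_half, X_one, Y_half, M_zero}"

lemmas alt_field_defs = V_plus_def D_field_def Y_minus_half_def X_one_def Y_half_def M_zero_def

definition alt_comb ::
  "real \<Rightarrow> real \<Rightarrow> real \<Rightarrow> real \<Rightarrow> real \<Rightarrow> real \<Rightarrow> real^3 \<Rightarrow> real^3" where
  "alt_comb a b c d e f = a *\<^sub>R V_plus + b *\<^sub>R D_field + c *\<^sub>R Y_minus_half
     + d *\<^sub>R X_one + e *\<^sub>R Y_half + f *\<^sub>R M_zero"

lemma alt_comb_apply:
  "alt_comb a b c d e f x = vector
    [- 2 * a * x $ 1 * x $ 2 - b * x $ 1 - d * (x $ 1)\<^sup>2,
     - a * ((x $ 2)\<^sup>2 + 2 * x $ 1 * x $ 3) - b * x $ 2 - c - d * x $ 1 * x $ 2 - e * x $ 1,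
     - 2 * a * x $ 3 * x $ 2 - b * x $ 3 - d * (x $ 2)\<^sup>2 / 2 - e * x $ 2 - f]"
  by (simp add: alt_comb_def alt_field_defs scaleR_fun_def vec_eq_iff forall_3 Let_def
      algebra_simps)

lemma span_alt_basis: "span alt_basis = {alt_comb a b c d e f | a b c d e f. True}"
proof -
  have "v \<in> span alt_basis \<longleftrightarrow> (\<exists>a b c d e f. v = alt_comb a b c d e f)" for v
    unfolding alt_basis_def span_insert span_empty alt_comb_def
    by (simp add: span_breakdown_eq algebra_simps eq_diff_eq[symmetric])
  then show ?thesis by blast
qed

definition alt_comb_deriv ::
  "real \<Rightarrow> real \<Rightarrow> real \<Rightarrow> real \<Rightarrow> real \<Rightarrow> real \<Rightarrow> real^3 \<Rightarrow> real^3 \<Rightarrow> real^3" where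
  "alt_comb_deriv a b c d e f x h = vector
    [- 2 * a * (h $ 1 * x $ 2 + x $ 1 * h $ 2) - b * h $ 1 - 2 * d * x $ 1 * h $ 1,
     - a * (2 * x $ 2 * h $ 2 + 2 * (h $ 1 * x $ 3 + x $ 1 * h $ 3)) - b * h $ 2
       - d * (h $ 1 * x $ 2 + x $ 1 * h $ 2) - e * h $ 1,
     - 2 * a * (h $ 3 * x $ 2 + x $ 3 * h $ 2) - b * h $ 3 - d * x $ 2 * h $ 2 - e * h $ 2]"

lemma alt_comb_has_derivative:
  "(alt_comb a b c d e f has_derivative alt_comb_deriv a b c d e f x) (at x)"
proof -
  have nth: "((\<lambda>x::real^3. x $ i) has_derivative (\<lambda>h. h $ i)) (at x)" for i
    by (rule bounded_linear_imp_has_derivative[OF bounded_linear_vec_nth])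
  have comp: "((\<lambda>x. alt_comb a b c d e f x $ i) has_derivative
      (\<lambda>h. alt_comb_deriv a b c d e f x h $ i)) (at x)" for i
  proof -
    consider "i = 1" | "i = 2" | "i = 3" using exhaust_3 by blast
    then show ?thesis
      by cases (auto simp: alt_comb_apply alt_comb_deriv_def power2_eq_square fun_eq_iff
          algebra_simps intro!: derivative_eq_intros nth)
  qed
  show ?thesis
    by (subst has_derivative_componentwise_within)
      (auto simp: Basis_vec_def inner_axis intro: comp)
qed

lemma frechet_derivative_alt_comb:
  "frechet_derivative (alt_comb a b c d e f) (at x) = alt_comb_deriv a b c d e f x"
  using frechet_derivative_at[OF alt_comb_has_derivative] by simp

lemma vf_bracket_alt_comb:
  "vf_bracket (alt_comb a b c d e f) (alt_comb a' b' c' d' e' f') =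
     alt_comb (a * b' - b * a')
       (2 * (a * c' - c * a'))
       (b * c' - c * b')
       (2 * (a * e' - e * a') - (b * d' - d * b'))
       (2 * (a * f' - f * a') - (c * d' - d * c'))
       (b * f' - f * b' - (c * e' - e * c'))"
  by (simp add: vf_bracket_def frechet_derivative_alt_comb alt_comb_deriv_def alt_comb_apply
      fun_eq_iff vec_eq_iff forall_3 field_simps power2_eq_square)

lemma alt_comb_0: "alt_comb 0 0 0 0 0 0 = 0"
  by (simp add: alt_comb_def)

lemma alt_comb_add:
  "alt_comb a b c d e f + alt_comb a' b' c' d' e' f' =
     alt_comb (a + a') (b + b') (c + c') (d + d') (e + e') (f + f')"
  by (simp add: alt_comb_def scaleR_add_left)

lemma alt_comb_scaleR:
  "k *\<^sub>R alt_comb a b c d e f = alt_comb (k * a) (k * b) (k * c) (k * d) (k * e) (k * f)"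
  by (simp add: alt_comb_def scaleR_add_right)

lemma alt_comb_eq_0_iff:
  "alt_comb a b c d e f = 0 \<longleftrightarrow> a = 0 \<and> b = 0 \<and> c = 0 \<and> d = 0 \<and> e = 0 \<and> f = 0"
proof
  assume *: "alt_comb a b c d e f = 0"
  have x: "alt_comb a b c d e f (vector [t, r, z]) = 0" for t r z
    using * by (simp add: fun_eq_iff)
  show "a = 0 \<and> b = 0 \<and> c = 0 \<and> d = 0 \<and> e = 0 \<and> f = 0"
    using x[of 0 0 0] x[of 1 0 0] x[of "-1" 0 0] x[of 0 1 0] x[of 0 0 1] x[of 1 1 0]
    by (simp add: alt_comb_apply vec_eq_iff forall_3)
qed (simp add: alt_comb_0)

typedef alt = "span alt_basis"
  using span_zero by blast

setup_lifting type_definition_alt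

lemma vf_bracket_alt:
  assumes "X \<in> span alt_basis" "Y \<in> span alt_basis"
  shows "vf_bracket X Y \<in> span alt_basis"
  using assms unfolding span_alt_basis by (force simp: vf_bracket_alt_comb)

instantiation alt :: real_vector
begin
lift_definition zero_alt :: alt is 0 by (rule span_zero)
lift_definition plus_alt :: "alt \<Rightarrow> alt \<Rightarrow> alt" is "(+)" by (rule span_add)
lift_definition uminus_alt :: "alt \<Rightarrow> alt" is uminus by (rule span_neg)
lift_definition minus_alt :: "alt \<Rightarrow> alt \<Rightarrow> alt" is "(-)" by (rule span_diff)
lift_definition scaleR_alt :: "real \<Rightarrow> alt \<Rightarrow> alt" is scaleR by (rule span_scale)
instance
  by standard (transfer; simp add: algebra_simps)+
end

lift_definition alt_of :: "real \<Rightarrow> real \<Rightarrow> real \<Rightarrow> real \<Rightarrow> real \<Rightarrow> real \<Rightarrow> alt" is alt_comb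
  unfolding span_alt_basis by blast

lemma alt_of_exhaust: obtains a b c d e f where "X = alt_of a b c d e f"
  by transfer (auto simp: span_alt_basis)

lemma alt_of_0: "alt_of 0 0 0 0 0 0 = 0"
  by transfer (rule alt_comb_0)

lemma alt_of_add:
  "alt_of a b c d e f + alt_of a' b' c' d' e' f' =
     alt_of (a + a') (b + b') (c + c') (d + d') (e + e') (f + f')"
  by transfer (rule alt_comb_add)

lemma alt_of_scaleR:
  "k *\<^sub>R alt_of a b c d e f = alt_of (k * a) (k * b) (k * c) (k * d) (k * e) (k * f)"
  by transfer (rule alt_comb_scaleR)

lemma alt_of_eq_0_iff:
  "alt_of a b c d e f = 0 \<longleftrightarrow> a = 0 \<and> b = 0 \<and> c = 0 \<and> d = 0 \<and> e = 0 \<and> f = 0"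
  by transfer (rule alt_comb_eq_0_iff)

lemma alt_of_eq_iff:
  "alt_of a b c d e f = alt_of a' b' c' d' e' f' \<longleftrightarrow>
     a = a' \<and> b = b' \<and> c = c' \<and> d = d' \<and> e = e' \<and> f = f'"
proof -
  have "alt_of a b c d e f = alt_of a' b' c' d' e' f' \<longleftrightarrow>
      alt_of a b c d e f + (-1) *\<^sub>R alt_of a' b' c' d' e' f' = 0"
    by simp
  then show ?thesis
    unfolding alt_of_scaleR alt_of_add alt_of_eq_0_iff by simp
qed

instantiation alt :: real_lie_algebra
begin

lift_definition lie_bracket_alt :: "alt \<Rightarrow> alt \<Rightarrow> alt" is vf_bracket
  by (rule vf_bracket_alt)

lemma lie_bracket_alt_of:
  "lie_bracket (alt_of a b c d e f) (alt_of a' b' c' d' e' f') =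
     alt_of (a * b' - b * a')
       (2 * (a * c' - c * a'))
       (b * c' - c * b')
       (2 * (a * e' - e * a') - (b * d' - d * b'))
       (2 * (a * f' - f * a') - (c * d' - d * c'))
       (b * f' - f * b' - (c * e' - e * c'))"
  by transfer (rule vf_bracket_alt_comb)

instance
proof
  fix x y z :: alt and k :: real
  obtain a b c d e f where x: "x = alt_of a b c d e f" by (rule alt_of_exhaust)
  obtain a' b' c' d' e' f' where y: "y = alt_of a' b' c' d' e' f'" by (rule alt_of_exhaust)
  obtain a'' b'' c'' d'' e'' f'' where z: "z = alt_of a'' b'' c'' d'' e'' f''"
    by (rule alt_of_exhaust)
  note simps = x y z lie_bracket_alt_of alt_of_add alt_of_scaleR
  show "lie_bracket (x + y) z = lie_bracket x z + lie_bracket y z"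
    by (simp add: simps alt_of_eq_iff algebra_simps)
  show "lie_bracket x (y + z) = lie_bracket x y + lie_bracket x z"
    by (simp add: simps alt_of_eq_iff algebra_simps)
  show "lie_bracket (k *\<^sub>R x) y = k *\<^sub>R lie_bracket x y"
    by (simp add: simps alt_of_eq_iff algebra_simps)
  show "lie_bracket x (k *\<^sub>R y) = k *\<^sub>R lie_bracket x y"
    by (simp add: simps alt_of_eq_iff algebra_simps)
  show "lie_bracket x x = 0"
    by (simp add: simps alt_of_eq_0_iff)
  show "lie_bracket x (lie_bracket y z) + lie_bracket y (lie_bracket z x)
      + lie_bracket z (lie_bracket x y) = 0"
    unfolding simps alt_of_eq_0_iff by (intro conjI; algebra)
qed

end

lemma card_alt_basis: "card alt_basis = 6" and independent_alt_basis: "independent alt_basis"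
proof -
  have comb: "V_plus = alt_comb 1 0 0 0 0 0" "D_field = alt_comb 0 1 0 0 0 0"
    "Y_minus_half = alt_comb 0 0 1 0 0 0" "X_one = alt_comb 0 0 0 1 0 0"
    "Y_half = alt_comb 0 0 0 0 1 0" "M_zero = alt_comb 0 0 0 0 0 1"
    by (simp_all add: alt_comb_def)
  have neq: "alt_comb a b c d e f \<noteq> alt_comb a' b' c' d' e' f'"
    if "\<not> (a = a' \<and> b = b' \<and> c = c' \<and> d = d' \<and> e = e' \<and> f = f')"
    for a b c d e f a' b' c' d' e' f'
  proof
    assume "alt_comb a b c d e f = alt_comb a' b' c' d' e' f'"
    then have "alt_comb a b c d e f + (-1) *\<^sub>R alt_comb a' b' c' d' e' f' = 0" by simp
    then show False using that unfolding alt_comb_scaleR alt_comb_add alt_comb_eq_0_iff by simp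
  qed
  show card: "card alt_basis = 6"
    unfolding alt_basis_def comb by (simp add: neq)
  have distinct: "V_plus \<noteq> D_field" "V_plus \<noteq> Y_minus_half" "V_plus \<noteq> X_one" "V_plus \<noteq> Y_half"
      "V_plus \<noteq> M_zero" "D_field \<noteq> Y_minus_half" "D_field \<noteq> X_one" "D_field \<noteq> Y_half"
      "D_field \<noteq> M_zero" "Y_minus_half \<noteq> X_one" "Y_minus_half \<noteq> Y_half" "Y_minus_half \<noteq> M_zero"
      "X_one \<noteq> Y_half" "X_one \<noteq> M_zero" "Y_half \<noteq> M_zero"
    unfolding comb by (simp_all add: neq)
  show "independent alt_basis"
  proof (rule independent_if_scalars_zero)
    show "finite alt_basis" by (simp add: alt_basis_def)
  next
    fix u v assume sum: "(\<Sum>x\<in>alt_basis. u x *\<^sub>R x) = 0" and v: "v \<in> alt_basis"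
    have "alt_comb (u V_plus) (u D_field) (u Y_minus_half) (u X_one) (u Y_half) (u M_zero) = 0"
      using sum distinct by (simp add: alt_basis_def alt_comb_def add.assoc)
    then show "u v = 0"
      using v unfolding alt_comb_eq_0_iff by (auto simp: alt_basis_def)
  qed
qed

section \<open>The Lie algebra \<open>sl(2,\<real>)\<close>\<close>

typedef sl2 = "{A :: real^2^2. trace A = 0}"
  by (rule exI[of _ 0]) (simp add: trace_def)

setup_lifting type_definition_sl2

lemma trace_scaleR: "trace (c *\<^sub>R (A :: real^'n^'n)) = c * trace A"
  by (simp add: trace_def sum_distrib_left)

lemma trace_uminus: "trace (- (A :: real^'n^'n)) = - trace A"
  by (simp add: trace_def sum_negf)

instantiation sl2 :: real_lie_algebra
begin
lift_definition zero_sl2 :: sl2 is 0 by (simp add: trace_def)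
lift_definition plus_sl2 :: "sl2 \<Rightarrow> sl2 \<Rightarrow> sl2" is "(+)" by (simp add: trace_add)
lift_definition uminus_sl2 :: "sl2 \<Rightarrow> sl2" is uminus by (simp add: trace_uminus)
lift_definition minus_sl2 :: "sl2 \<Rightarrow> sl2 \<Rightarrow> sl2" is "(-)" by (simp add: trace_sub)
lift_definition scaleR_sl2 :: "real \<Rightarrow> sl2 \<Rightarrow> sl2" is scaleR by (simp add: trace_scaleR)
lift_definition lie_bracket_sl2 :: "sl2 \<Rightarrow> sl2 \<Rightarrow> sl2" is matrix_commutator
  unfolding matrix_commutator_def trace_sub by (subst trace_mul_sym) simp
instance
proof
  fix x y z :: sl2 and c d :: real
  show "x + y + z = x + (y + z)" "x + y = y + x" "0 + x = x" "- x + x = 0" "x - y = x + - y"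
    "c *\<^sub>R (x + y) = c *\<^sub>R x + c *\<^sub>R y" "(c + d) *\<^sub>R x = c *\<^sub>R x + d *\<^sub>R x"
    "c *\<^sub>R d *\<^sub>R x = (c * d) *\<^sub>R x" "1 *\<^sub>R x = x"
    by (transfer, simp add: algebra_simps)+
  show "lie_bracket (x + y) z = lie_bracket x z + lie_bracket y z"
    "lie_bracket x (y + z) = lie_bracket x y + lie_bracket x z"
    "lie_bracket (c *\<^sub>R x) y = c *\<^sub>R lie_bracket x y"
    "lie_bracket x (c *\<^sub>R y) = c *\<^sub>R lie_bracket x y"
    "lie_bracket x x = 0"
    by (transfer, simp add: matrix_commutator_def matrix_commutator_algebra algebra_simps)+
  show "lie_bracket x (lie_bracket y z) + lie_bracket y (lie_bracket z x)
      + lie_bracket z (lie_bracket x y) = 0"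
    by (transfer, rule matrix_commutator_jacobi)
qed
end

section \<open>The Lie algebra \<open>so(2,1)\<close> and the Poincare algebra\<close>

text \<open>The quadratic form has signature \<open>(+,+,-)\<close>; the last coordinate is time.\<close>

definition minkowski :: "real^3^3" where
  "minkowski = (\<chi> i j. if i = j then (if i = 3 then - 1 else 1) else 0)"

typedef so21 = "{A :: real^3^3. transpose A ** minkowski + minkowski ** A = 0}"
  by (rule exI[of _ 0]) (simp add: transpose_def vec_eq_iff matrix_matrix_mult_def)

setup_lifting type_definition_so21

lemma transpose_add: "transpose (A + B) = transpose A + transpose (B :: real^'n^'n)"
  by (simp add: transpose_def vec_eq_iff)

lemma transpose_diff: "transpose (A - B) = transpose A - transpose (B :: real^'n^'n)"
  by (simp add: transpose_def vec_eq_iff)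

lemma so21_subspace:
  "subspace {A :: real^3^3. transpose A ** minkowski + minkowski ** A = 0}"
proof -
  have "linear (\<lambda>A :: real^3^3. transpose A ** minkowski + minkowski ** A)"
    by (rule linearI)
      (simp_all add: transpose_add transpose_scalar matrix_commutator_algebra scaleR_add_right)
  from linear_subspace_vimage[OF this subspace_single_0] show ?thesis
    by (simp add: vimage_def)
qed

lemma so21_commutator:
  assumes "transpose A ** M + M ** A = 0" "transpose B ** M + M ** B = (0 :: real^'n^'n)"
  shows "transpose (matrix_commutator A B) ** M + M ** matrix_commutator A B = 0"
proof -
  have A: "transpose A ** M = - (M ** A)" and B: "transpose B ** M = - (M ** B)"
    using assms by (simp_all add: eq_neg_iff_add_eq_0)
  have "transpose B ** transpose A ** M = M ** B ** A"
    by (simp add: matrix_mul_assoc[symmetric] A matrix_mult_uminus_right)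
      (simp add: matrix_mul_assoc B matrix_mult_uminus_left)
  moreover have "transpose A ** transpose B ** M = M ** A ** B"
    by (simp add: matrix_mul_assoc[symmetric] B matrix_mult_uminus_right)
      (simp add: matrix_mul_assoc A matrix_mult_uminus_left)
  ultimately show ?thesis
    by (simp add: matrix_commutator_def matrix_transpose_mul transpose_diff
        matrix_mult_diff_left matrix_mult_diff_right matrix_mul_assoc)
qed

instantiation so21 :: real_lie_algebra
begin
lift_definition zero_so21 :: so21 is 0
  by (rule subspace_0[OF so21_subspace, unfolded mem_Collect_eq])
lift_definition plus_so21 :: "so21 \<Rightarrow> so21 \<Rightarrow> so21" is "(+)"
  by (rule subspace_add[OF so21_subspace, unfolded mem_Collect_eq])
lift_definition uminus_so21 :: "so21 \<Rightarrow> so21" is uminus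
  by (rule subspace_neg[OF so21_subspace, unfolded mem_Collect_eq])
lift_definition minus_so21 :: "so21 \<Rightarrow> so21 \<Rightarrow> so21" is "(-)"
  by (rule subspace_diff[OF so21_subspace, unfolded mem_Collect_eq])
lift_definition scaleR_so21 :: "real \<Rightarrow> so21 \<Rightarrow> so21" is scaleR
  by (rule subspace_scale[OF so21_subspace, unfolded mem_Collect_eq])
lift_definition lie_bracket_so21 :: "so21 \<Rightarrow> so21 \<Rightarrow> so21" is matrix_commutator
  by (rule so21_commutator)
instance
proof
  fix x y z :: so21 and c d :: real
  show "x + y + z = x + (y + z)" "x + y = y + x" "0 + x = x" "- x + x = 0" "x - y = x + - y"
    "c *\<^sub>R (x + y) = c *\<^sub>R x + c *\<^sub>R y" "(c + d) *\<^sub>R x = c *\<^sub>R x + d *\<^sub>R x"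
    "c *\<^sub>R d *\<^sub>R x = (c * d) *\<^sub>R x" "1 *\<^sub>R x = x"
    by (transfer, simp add: algebra_simps)+
  show "lie_bracket (x + y) z = lie_bracket x z + lie_bracket y z"
    "lie_bracket x (y + z) = lie_bracket x y + lie_bracket x z"
    "lie_bracket (c *\<^sub>R x) y = c *\<^sub>R lie_bracket x y"
    "lie_bracket x (c *\<^sub>R y) = c *\<^sub>R lie_bracket x y"
    "lie_bracket x x = 0"
    by (transfer, simp add: matrix_commutator_def matrix_commutator_algebra algebra_simps)+
  show "lie_bracket x (lie_bracket y z) + lie_bracket y (lie_bracket z x)
      + lie_bracket z (lie_bracket x y) = 0"
    by (transfer, rule matrix_commutator_jacobi)
qed
end

lift_definition so21_act :: "so21 \<Rightarrow> real^3 \<Rightarrow> real^3" is "(*v)" .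

lemma so21_act_algebra:
  "so21_act (A + B) v = so21_act A v + so21_act B v"
  "so21_act A (v + w) = so21_act A v + so21_act A w"
  "so21_act A (v - w) = so21_act A v - so21_act A w"
  "so21_act (c *\<^sub>R A) v = c *\<^sub>R so21_act A v"
  "so21_act A (c *\<^sub>R v) = c *\<^sub>R so21_act A v"
  "so21_act (lie_bracket A B) v = so21_act A (so21_act B v) - so21_act B (so21_act A v)"
  by (transfer; simp add: matrix_vector_mult_add_rdistrib matrix_vector_right_distrib
      matrix_vector_mult_diff_distrib scaleR_matrix_vector_assoc matrix_vector_mult_scaleR
      matrix_commutator_def matrix_vector_mult_diff_rdistrib matrix_vector_mul_assoc)+

text \<open>
  \<open>so(2,1) \<ltimes> \<real>\<^sup>3\<close>: pairs of an infinitesimal Lorentz transformation and a translation.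
  The translations form an abelian ideal, on which \<open>A\<close> acts by \<open>[(A,0),(0,w)] = (0, A w)\<close>.
\<close>

typedef poincare3 = "UNIV :: (so21 \<times> (real^3)) set"
  by simp

setup_lifting type_definition_poincare3

instantiation poincare3 :: real_lie_algebra
begin
lift_definition zero_poincare3 :: poincare3 is 0 .
lift_definition plus_poincare3 :: "poincare3 \<Rightarrow> poincare3 \<Rightarrow> poincare3" is "(+)" .
lift_definition uminus_poincare3 :: "poincare3 \<Rightarrow> poincare3" is uminus .
lift_definition minus_poincare3 :: "poincare3 \<Rightarrow> poincare3 \<Rightarrow> poincare3" is "(-)" .
lift_definition scaleR_poincare3 :: "real \<Rightarrow> poincare3 \<Rightarrow> poincare3" is scaleR .
lift_definition lie_bracket_poincare3 :: "poincare3 \<Rightarrow> poincare3 \<Rightarrow> poincare3" is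
  "\<lambda>(A, v) (B, w). (lie_bracket A B, so21_act A w - so21_act B v)" .
instance
proof
  fix x y z :: poincare3 and c d :: real
  show "x + y + z = x + (y + z)" "x + y = y + x" "0 + x = x" "- x + x = 0" "x - y = x + - y"
    "c *\<^sub>R (x + y) = c *\<^sub>R x + c *\<^sub>R y" "(c + d) *\<^sub>R x = c *\<^sub>R x + d *\<^sub>R x"
    "c *\<^sub>R d *\<^sub>R x = (c * d) *\<^sub>R x" "1 *\<^sub>R x = x"
    by (transfer, simp add: algebra_simps)+
  show "lie_bracket (x + y) z = lie_bracket x z + lie_bracket y z"
    "lie_bracket x (y + z) = lie_bracket x y + lie_bracket x z"
    "lie_bracket (c *\<^sub>R x) y = c *\<^sub>R lie_bracket x y"
    "lie_bracket x (c *\<^sub>R y) = c *\<^sub>R lie_bracket x y"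
    "lie_bracket x x = 0"
    by (transfer, auto simp: so21_act_algebra lie_bracket_add_left lie_bracket_add_right
        lie_bracket_scaleR_left lie_bracket_scaleR_right lie_bracket_self zero_prod_def
        scaleR_diff_right)+
  show "lie_bracket x (lie_bracket y z) + lie_bracket y (lie_bracket z x)
      + lie_bracket z (lie_bracket x y) = 0"
    by (transfer, auto simp: so21_act_algebra lie_bracket_jacobi zero_prod_def)
qed
end

section \<open>The truncated polynomial ring \<open>\<real>[\<epsilon>]/\<epsilon>\<^sup>2\<close>\<close>

quotient_type dual_number = "real poly" / "\<lambda>p q. [:0, 1:] ^ 2 dvd p - q"
proof (rule equivpI)
  show "reflp (\<lambda>p q :: real poly. [:0, 1:] ^ 2 dvd p - q)"
    by (simp add: reflp_def)
  show "symp (\<lambda>p q :: real poly. [:0, 1:] ^ 2 dvd p - q)"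
    by (rule sympI) (subst dvd_diff_commute)
  show "transp (\<lambda>p q :: real poly. [:0, 1:] ^ 2 dvd p - q)"
  proof (rule transpI)
    fix p q r :: "real poly"
    assume "[:0, 1:] ^ 2 dvd p - q" "[:0, 1:] ^ 2 dvd q - r"
    from dvd_add[OF this] show "[:0, 1:] ^ 2 dvd p - r" by simp
  qed
qed

instantiation dual_number :: "{comm_ring_1, real_algebra_1}"
begin
lift_definition zero_dual_number :: dual_number is 0 .
lift_definition one_dual_number :: dual_number is 1 .
lift_definition plus_dual_number :: "dual_number \<Rightarrow> dual_number \<Rightarrow> dual_number" is "(+)"
  by (simp only: add_diff_add) (rule dvd_add)
lift_definition uminus_dual_number :: "dual_number \<Rightarrow> dual_number" is uminus
  by (simp only: minus_diff_minus dvd_minus_iff)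
lift_definition minus_dual_number :: "dual_number \<Rightarrow> dual_number \<Rightarrow> dual_number" is "(-)"
proof -
  fix p p' q q' :: "real poly"
  assume "[:0, 1:] ^ 2 dvd p - p'" "[:0, 1:] ^ 2 dvd q - q'"
  then have "[:0, 1:] ^ 2 dvd (p - p') - (q - q')" by (rule dvd_diff)
  also have "(p - p') - (q - q') = (p - q) - (p' - q')" by simp
  finally show "[:0, 1:] ^ 2 dvd (p - q) - (p' - q')" .
qed
lift_definition times_dual_number :: "dual_number \<Rightarrow> dual_number \<Rightarrow> dual_number" is "(*)"
proof -
  fix p p' q q' :: "real poly"
  assume "[:0, 1:] ^ 2 dvd p - p'" "[:0, 1:] ^ 2 dvd q - q'"
  then have "[:0, 1:] ^ 2 dvd (p - p') * q + p' * (q - q')" by (intro dvd_add dvd_mult dvd_mult2)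
  also have "(p - p') * q + p' * (q - q') = p * q - p' * q'" by (simp add: algebra_simps)
  finally show "[:0, 1:] ^ 2 dvd p * q - p' * q'" .
qed
lift_definition scaleR_dual_number :: "real \<Rightarrow> dual_number \<Rightarrow> dual_number" is smult
  by (simp only: smult_diff_right[symmetric]) (rule dvd_smult)
instance
proof
  show "(0 :: dual_number) \<noteq> 1"
  proof transfer
    show "\<not> [:0, 1:] ^ 2 dvd 0 - (1 :: real poly)"
    proof
      assume "[:0, 1:] ^ 2 dvd 0 - (1 :: real poly)"
      from dvd_imp_degree_le[OF this] show False by (simp add: degree_power_eq)
    qed
  qed
qed (transfer; simp add: algebra_simps smult_add_left smult_add_right)+
end

lift_definition dual_eps :: dual_number is "[:0, 1:]" .

lemma dual_eps_square: "dual_eps ^ 2 = 0"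
  unfolding power2_eq_square by transfer (simp add: power2_eq_square)

section \<open>Tensor products of real vector spaces\<close>

text \<open>
  The tensor product is the free real vector space on the set of pairs, modulo the subspace
  generated by the relations expressing bilinearity of the pure tensors.
\<close>

abbreviation free_gen :: "'k \<Rightarrow> 'k \<Rightarrow>\<^sub>0 real" where
  "free_gen k \<equiv> Poly_Mapping.single k 1"

definition tensor_relations :: "(('a::real_vector \<times> 'b::real_vector) \<Rightarrow>\<^sub>0 real) set" where
  "tensor_relations =
     {free_gen (x + x', y) - (free_gen (x, y) + free_gen (x', y)) | x x' y. True}
   \<union> {free_gen (x, y + y') - (free_gen (x, y) + free_gen (x, y')) | x y y'. True}
   \<union> {free_gen (c *\<^sub>R x, y) - c *\<^sub>R free_gen (x, y) | c x y. True}
   \<union> {free_gen (x, c *\<^sub>R y) - c *\<^sub>R free_gen (x, y) | c x y. True}"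

quotient_type (overloaded) ('a, 'b) tensor =
  "('a::real_vector \<times> 'b::real_vector) \<Rightarrow>\<^sub>0 real" /
  "\<lambda>f g. f - g \<in> span tensor_relations"
proof (rule equivpI)
  show "reflp (\<lambda>f g :: ('a \<times> 'b) \<Rightarrow>\<^sub>0 real. f - g \<in> span tensor_relations)"
    by (simp add: reflp_def span_zero)
  show "symp (\<lambda>f g :: ('a \<times> 'b) \<Rightarrow>\<^sub>0 real. f - g \<in> span tensor_relations)"
    by (rule sympI) (metis minus_diff_eq span_neg)
  show "transp (\<lambda>f g :: ('a \<times> 'b) \<Rightarrow>\<^sub>0 real. f - g \<in> span tensor_relations)"
  proof (rule transpI)
    fix f g h :: "('a \<times> 'b) \<Rightarrow>\<^sub>0 real"
    assume "f - g \<in> span tensor_relations" "g - h \<in> span tensor_relations"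
    from span_add[OF this] show "f - h \<in> span tensor_relations" by simp
  qed
qed

instantiation tensor :: (real_vector, real_vector) real_vector
begin
lift_definition zero_tensor :: "('a, 'b) tensor" is 0 .
lift_definition plus_tensor :: "('a, 'b) tensor \<Rightarrow> ('a, 'b) tensor \<Rightarrow> ('a, 'b) tensor" is "(+)"
  by (simp only: add_diff_add) (rule span_add)
lift_definition uminus_tensor :: "('a, 'b) tensor \<Rightarrow> ('a, 'b) tensor" is uminus
  by (simp only: minus_diff_minus) (rule span_neg)
lift_definition minus_tensor :: "('a, 'b) tensor \<Rightarrow> ('a, 'b) tensor \<Rightarrow> ('a, 'b) tensor" is "(-)"
proof -
  fix f1 f2 g1 g2 :: "('a \<times> 'b) \<Rightarrow>\<^sub>0 real"
  assume "f1 - f2 \<in> span tensor_relations" "g1 - g2 \<in> span tensor_relations"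
  from span_diff[OF this] show "f1 - g1 - (f2 - g2) \<in> span tensor_relations"
    by (simp add: algebra_simps)
qed
lift_definition scaleR_tensor :: "real \<Rightarrow> ('a, 'b) tensor \<Rightarrow> ('a, 'b) tensor" is scaleR
  by (simp only: scaleR_diff_right[symmetric]) (rule span_scale)
instance
  by standard (transfer; simp add: algebra_simps span_zero)+
end

lift_definition pure_tensor :: "'a::real_vector \<Rightarrow> 'b::real_vector \<Rightarrow> ('a, 'b) tensor"
  (infixr \<open>\<otimes>\<close> 75) is "\<lambda>x y. free_gen (x, y)" .

lemma tensor_relationsI:
  "free_gen (x + x', y) - (free_gen (x, y) + free_gen (x', y)) \<in> span tensor_relations"
  "free_gen (x, y + y') - (free_gen (x, y) + free_gen (x, y')) \<in> span tensor_relations"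
  "free_gen (c *\<^sub>R x, y) - c *\<^sub>R free_gen (x, y) \<in> span tensor_relations"
  "free_gen (x, c *\<^sub>R y) - c *\<^sub>R free_gen (x, y) \<in> span tensor_relations"
  by (rule span_base; unfold tensor_relations_def; blast)+

lemma tensor_relationsE:
  assumes "r \<in> tensor_relations"
  obtains (add_left) x x' y where "r = free_gen (x + x', y) - (free_gen (x, y) + free_gen (x', y))"
  | (add_right) x y y' where "r = free_gen (x, y + y') - (free_gen (x, y) + free_gen (x, y'))"
  | (scale_left) c x y where "r = free_gen (c *\<^sub>R x, y) - c *\<^sub>R free_gen (x, y)"
  | (scale_right) c x y where "r = free_gen (x, c *\<^sub>R y) - c *\<^sub>R free_gen (x, y)"
  using assms unfolding tensor_relations_def by blast

lemma pure_tensor_bilinear: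
  "(x + x') \<otimes> y = x \<otimes> y + x' \<otimes> y"
  "x \<otimes> (y + y') = x \<otimes> y + x \<otimes> y'"
  "(c *\<^sub>R x) \<otimes> y = c *\<^sub>R (x \<otimes> y)"
  "x \<otimes> (c *\<^sub>R y) = c *\<^sub>R (x \<otimes> y)"
  by (transfer; rule tensor_relationsI)+

definition free_extend :: "('k \<Rightarrow> 'v::real_vector) \<Rightarrow> ('k \<Rightarrow>\<^sub>0 real) \<Rightarrow> 'v" where
  "free_extend \<phi> f = (\<Sum>k\<in>Poly_Mapping.keys f. Poly_Mapping.lookup f k *\<^sub>R \<phi> k)"

lemma free_extend_superset:
  assumes "finite S" "Poly_Mapping.keys f \<subseteq> S"
  shows "free_extend \<phi> f = (\<Sum>k\<in>S. Poly_Mapping.lookup f k *\<^sub>R \<phi> k)"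
  unfolding free_extend_def using assms
  by (intro sum.mono_neutral_left) (auto simp: in_keys_iff)

lemma lookup_scaleR: "Poly_Mapping.lookup (c *\<^sub>R f) k = c *\<^sub>R Poly_Mapping.lookup f k"
  by (simp add: scaleR_poly_mapping_def)

lemma linear_free_extend: "linear (free_extend \<phi>)"
proof (rule linearI)
  fix f g :: "'a \<Rightarrow>\<^sub>0 real" and c :: real
  let ?S = "Poly_Mapping.keys f \<union> Poly_Mapping.keys g"
  have "Poly_Mapping.keys (f + g) \<subseteq> ?S" by (rule Poly_Mapping.keys_add)
  then show "free_extend \<phi> (f + g) = free_extend \<phi> f + free_extend \<phi> g"
    by (simp add: free_extend_superset[of ?S] lookup_add scaleR_add_left sum.distrib)
  have "Poly_Mapping.keys (c *\<^sub>R f) \<subseteq> Poly_Mapping.keys f"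
    by (auto simp: in_keys_iff lookup_scaleR)
  then show "free_extend \<phi> (c *\<^sub>R f) = c *\<^sub>R free_extend \<phi> f"
    by (simp add: free_extend_superset[of "Poly_Mapping.keys f"] lookup_scaleR scaleR_sum_right)
qed

lemma free_extend_gen [simp]: "free_extend \<phi> (free_gen k) = \<phi> k"
  by (simp add: free_extend_def)

lemma free_expansion: "free_extend free_gen f = f"
proof (rule poly_mapping_eqI)
  fix k
  have "Poly_Mapping.lookup (\<Sum>j\<in>S. Poly_Mapping.lookup f j *\<^sub>R free_gen j) k
      = (\<Sum>j\<in>S. Poly_Mapping.lookup f j * (if j = k then 1 else 0))" for S
    by (induction S rule: infinite_finite_induct)
      (auto simp: lookup_add lookup_scaleR lookup_single when_def)
  then show "Poly_Mapping.lookup (free_extend free_gen f) k = Poly_Mapping.lookup f k"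
    by (simp add: free_extend_def sum.delta if_distrib in_keys_iff cong: if_cong)
qed

lemma linear_into_subspace:
  assumes "linear L" "subspace S" "\<And>k. L (free_gen k) \<in> S"
  shows "L f \<in> S"
proof -
  have "L f = L (free_extend free_gen f)" by (simp add: free_expansion)
  also have "\<dots> = (\<Sum>k\<in>Poly_Mapping.keys f. Poly_Mapping.lookup f k *\<^sub>R L (free_gen k))"
    unfolding free_extend_def using assms(1) by (simp add: linear_sum linear_scale)
  also have "\<dots> \<in> S" by (intro subspace_sum subspace_scale assms)
  finally show ?thesis .
qed

lemma span_pure_tensors: "span {x \<otimes> y | x y. True} = UNIV"
proof -
  have "t \<in> span {x \<otimes> y | x y. True}" for t :: "('a, 'b) tensor"
  proof (induct t rule: tensor.abs_induct)
    case (1 f)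
    show ?case
    proof (rule linear_into_subspace)
      show "linear (abs_tensor :: _ \<Rightarrow> ('a, 'b) tensor)"
        by (rule linearI) (simp_all add: plus_tensor.abs_eq scaleR_tensor.abs_eq)
      show "abs_tensor (free_gen k) \<in> span {x \<otimes> y | x y. True}" for k :: "'a \<times> 'b"
        by (rule span_base) (cases k; auto simp: pure_tensor.abs_eq)
    qed simp
  qed
  then show ?thesis by blast
qed

lemma linear_eq_on_pure_tensors:
  assumes "linear f" "linear g" "\<And>x y. f (x \<otimes> y) = g (x \<otimes> y)"
  shows "f t = g t"
proof (rule linear_eq_on_span[OF assms(1,2)])
  show "t \<in> span {x \<otimes> y | x y. True}" unfolding span_pure_tensors by (rule UNIV_I)
  show "f x = g x" if "x \<in> {x \<otimes> y | x y. True}" for x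
    using that assms(3) by blast
qed

section \<open>The Lie algebra \<open>g \<otimes> A\<close> for a commutative algebra \<open>A\<close>\<close>

text \<open>The bilinear extension of \<open>(x,a), (y,b) \<mapsto> ([x,y], ab)\<close> to the free vector space.\<close>

definition free_bracket ::
  "('a::real_lie_algebra \<times> 'b::{comm_ring_1, real_algebra_1} \<Rightarrow>\<^sub>0 real) \<Rightarrow>
   ('a \<times> 'b \<Rightarrow>\<^sub>0 real) \<Rightarrow> ('a \<times> 'b \<Rightarrow>\<^sub>0 real)" where
  "free_bracket f g =
     free_extend (\<lambda>(x, a). free_extend (\<lambda>(y, b). free_gen (lie_bracket x y, a * b)) g) f"

lemma linear_free_bracket_left: "linear (\<lambda>f. free_bracket f g)"
  unfolding free_bracket_def by (rule linear_free_extend)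

lemma linear_free_bracket_right: "linear (\<lambda>g. free_bracket f g)"
  unfolding free_bracket_def free_extend_def[of _ f]
  by (auto intro!: linear_compose_sum linear_compose_scale_right linear_free_extend
      simp: split_beta)

lemma free_bracket_gen:
  "free_bracket (free_gen (x, a)) (free_gen (y, b)) = free_gen (lie_bracket x y, a * b)"
  by (simp add: free_bracket_def)

lemma free_bracket_relation_left:
  assumes "r \<in> span tensor_relations"
  shows "free_bracket r g \<in> span tensor_relations"
proof (rule linear_into_subspace[OF linear_free_bracket_right])
  show "free_bracket r (free_gen k) \<in> span tensor_relations" for k
    using assms
  proof (induct rule: span_induct)
    case base
    then show ?case
      using linear_subspace_vimage[OF linear_free_bracket_left subspace_span]
      by (simp add: vimage_def)
  next
    case (step s)
    obtain y b where k: "k = (y, b)" by (cases k)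
    note lin = linear_free_bracket_left[of "free_gen (y, b)"]
    note simps = linear_diff[OF lin] linear_add[OF lin] linear_scale[OF lin] free_bracket_gen
    from step show ?case
      unfolding k
      by (elim tensor_relationsE)
        (simp_all add: simps lie_bracket_add_left lie_bracket_scaleR_left distrib_right tensor_relationsI)
  qed
qed simp

lemma free_bracket_relation_right:
  assumes "r \<in> span tensor_relations"
  shows "free_bracket g r \<in> span tensor_relations"
proof (rule linear_into_subspace[OF linear_free_bracket_left])
  show "free_bracket (free_gen k) r \<in> span tensor_relations" for k
    using assms
  proof (induct rule: span_induct)
    case base
    then show ?case
      using linear_subspace_vimage[OF linear_free_bracket_right subspace_span]
      by (simp add: vimage_def)
  next
    case (step s)
    obtain y b where k: "k = (y, b)" by (cases k)
    note lin = linear_free_bracket_right[of "free_gen (y, b)"]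
    note simps = linear_diff[OF lin] linear_add[OF lin] linear_scale[OF lin] free_bracket_gen
    from step show ?case
      unfolding k
      by (elim tensor_relationsE)
        (simp_all add: simps lie_bracket_add_right lie_bracket_scaleR_right distrib_left tensor_relationsI)
  qed
qed simp

instantiation tensor ::
  (real_lie_algebra, "{comm_ring_1, real_algebra_1}") real_lie_algebra
begin

lift_definition lie_bracket_tensor ::
  "('a, 'b) tensor \<Rightarrow> ('a, 'b) tensor \<Rightarrow> ('a, 'b) tensor" is free_bracket
proof -
  fix f f' g g' :: "'a \<times> 'b \<Rightarrow>\<^sub>0 real"
  assume "f - f' \<in> span tensor_relations" "g - g' \<in> span tensor_relations"
  then have "free_bracket (f - f') g + free_bracket f' (g - g') \<in> span tensor_relations"
    by (intro span_add free_bracket_relation_left free_bracket_relation_right)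
  then show "free_bracket f g - free_bracket f' g' \<in> span tensor_relations"
    by (simp add: linear_diff[OF linear_free_bracket_left]
        linear_diff[OF linear_free_bracket_right])
qed

lemma lie_bracket_pure_tensor:
  "lie_bracket (x \<otimes> a) (y \<otimes> b) = lie_bracket x y \<otimes> (a * b :: 'b)" for x y :: 'a
  by transfer (simp add: free_bracket_gen span_zero)

lemma linear_lie_bracket_tensor:
  "linear (\<lambda>s. lie_bracket s (t :: ('a, 'b) tensor))"
  "linear (\<lambda>s. lie_bracket (t :: ('a, 'b) tensor) s)"
  by (rule linearI; transfer;
      simp add: linear_add[OF linear_free_bracket_left] linear_scale[OF linear_free_bracket_left]
        linear_add[OF linear_free_bracket_right] linear_scale[OF linear_free_bracket_right]
        span_zero)+

instance
proof
  fix s t u :: "('a, 'b) tensor" and c :: real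
  note lin = linear_lie_bracket_tensor
  show "lie_bracket (s + t) u = lie_bracket s u + lie_bracket t u"
    by (rule linear_add[OF lin(1)])
  show "lie_bracket s (t + u) = lie_bracket s t + lie_bracket s u"
    by (rule linear_add[OF lin(2)])
  show "lie_bracket (c *\<^sub>R s) t = c *\<^sub>R lie_bracket s t"
    by (rule linear_scale[OF lin(1)])
  show "lie_bracket s (c *\<^sub>R t) = c *\<^sub>R lie_bracket s t"
    by (rule linear_scale[OF lin(2)])
  have pure0: "(0::'a) \<otimes> a = 0" for a :: 'b
    using pure_tensor_bilinear(3)[of 0 0 a] by simp
  have antisym: "lie_bracket x y + lie_bracket y x = 0" for x y :: 'a
    by (rule lie_bracket_antisym)
  have "lie_bracket s t + lie_bracket t s = 0" for s t :: "('a, 'b) tensor"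
  proof (rule linear_eq_on_pure_tensors[of "\<lambda>s. lie_bracket s t + lie_bracket t s" "\<lambda>_. 0"])
    fix x :: 'a and a :: 'b
    show "lie_bracket (x \<otimes> a) t + lie_bracket t (x \<otimes> a) = 0"
      by (rule linear_eq_on_pure_tensors[where
            f = "\<lambda>t. lie_bracket (x \<otimes> a) t + lie_bracket t (x \<otimes> a)" and g = "\<lambda>_. 0"])
        (auto intro!: linear_compose_add lin linear_zero simp: lie_bracket_pure_tensor
          mult.commute[of _ a] antisym pure0 simp flip: pure_tensor_bilinear(1))
  qed (auto intro!: linear_compose_add lin linear_zero)
  from this[of s s] show "lie_bracket s s = 0"
    by (simp flip: scaleR_2)
  let ?J = "\<lambda>s t u :: ('a, 'b) tensor. lie_bracket s (lie_bracket t u)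
    + lie_bracket t (lie_bracket u s) + lie_bracket u (lie_bracket s t)"
  note lin2 = linear_compose[OF lin(1) lin(1), unfolded o_def]
    linear_compose[OF lin(1) lin(2), unfolded o_def]
    linear_compose[OF lin(2) lin(1), unfolded o_def]
    linear_compose[OF lin(2) lin(2), unfolded o_def]
  have pure: "?J (x \<otimes> a) (y \<otimes> b) (z \<otimes> c) = 0" for x y z :: 'a and a b c :: 'b
    by (simp add: lie_bracket_pure_tensor mult.commute mult.left_commute lie_bracket_jacobi pure0
        flip: pure_tensor_bilinear(1))
  have "?J (x \<otimes> a) (y \<otimes> b) u = 0" for x y :: 'a and a b :: 'b and u
    by (rule linear_eq_on_pure_tensors[where f = "?J (x \<otimes> a) (y \<otimes> b)" and g = "\<lambda>_. 0"])
      (auto intro!: linear_compose_add lin lin2 linear_zero pure)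
  then have "?J (x \<otimes> a) t u = 0" for x :: 'a and a :: 'b and t u
    by (rule_tac linear_eq_on_pure_tensors[where f = "\<lambda>t. ?J (x \<otimes> a) t u" and g = "\<lambda>_. 0"])
      (auto intro!: linear_compose_add lin lin2 linear_zero)
  then show "?J s t u = 0"
    by (rule_tac linear_eq_on_pure_tensors[where f = "\<lambda>s. ?J s t u" and g = "\<lambda>_. 0"])
      (auto intro!: linear_compose_add lin lin2 linear_zero)
qed

end

end

theory Submission
  imports Defs
begin

text \<open>
  The fields \<open>V\<^sub>+, D, Y\<^sub>-\<^sub>1\<^sub>/\<^sub>2\<close> span a copy of \<open>sl(2,\<real>)\<close>, namely \<open>V\<^sub>+ = -F\<close>, \<open>D = H/2\<close>,
  \<open>Y\<^sub>-\<^sub>1\<^sub>/\<^sub>2 = E\<close>, and \<open>X\<^sub>1, Y\<^sub>1\<^sub>/\<^sub>2, M\<^sub>0\<close> span an abelian ideal on which it acts by the adjoint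
  representation, with \<open>2 X\<^sub>1 = -F\<epsilon>\<close>, \<open>Y\<^sub>1\<^sub>/\<^sub>2 = (H/2)\<epsilon>\<close>, \<open>M\<^sub>0 = E\<epsilon>\<close>. Minus the determinant
  is an invariant quadratic form of signature \<open>(2,1)\<close> on \<open>sl(2,\<real>)\<close>, so the adjoint representation
  identifies \<open>sl(2,\<real>)\<close> with \<open>so(2,1)\<close> and the ideal with the vector representation.
\<close>

section \<open>Criteria for Lie isomorphisms and their inverses\<close>

lemma lie_isomorphismI:
  assumes "linear f" "\<And>x. f x = 0 \<Longrightarrow> x = 0" "\<And>y. \<exists>x. f x = y"
    and "\<And>x y. f (lie_bracket x y) = lie_bracket (f x) (f y)"
  shows "lie_isomorphism f"
proof -
  have "inj f" using assms(1,2) by (simp add: linear_injective_0)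
  moreover have "surj f" using assms(3) by (metis surjI)
  ultimately show ?thesis using assms by (simp add: lie_isomorphism_def bij_def)
qed

text \<open>The universal property yields maps out of a tensor product, so the isomorphisms are
  built with values in \<open>alt\<close> and then reversed.\<close>

lemma lie_isomorphism_inv:
  assumes "lie_isomorphism f"
  shows "lie_isomorphism (inv f)"
proof -
  have lin: "linear f" and bij: "bij f"
    and bracket: "f (lie_bracket x y) = lie_bracket (f x) (f y)" for x y
    using assms by (auto simp: lie_isomorphism_def)
  have inv: "inv f y = x \<longleftrightarrow> y = f x" for x y
    using bij by (metis bij_inv_eq_iff)
  have f_inv: "f (inv f y) = y" for y using inv by metis
  have "linear (inv f)"
    by (rule linearI) (simp_all add: inv linear_add[OF lin] linear_scale[OF lin] f_inv)
  then show ?thesis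
    using bij by (simp add: lie_isomorphism_def bij_imp_bij_inv inv bracket f_inv)
qed

section \<open>The universal property of the tensor product\<close>

lemma pure_tensor_zero [simp]: "0 \<otimes> y = 0" "x \<otimes> 0 = 0"
  using pure_tensor_bilinear(3)[of 0 0 y] pure_tensor_bilinear(4)[of x 0 0] by simp_all

text \<open>The linear extension of \<open>\<beta>\<close> to the free space kills the four families
  of bilinearity relations, so it descends to the quotient.\<close>

lemma tensor_universal:
  fixes \<beta> :: "'a::real_vector \<Rightarrow> 'b::real_vector \<Rightarrow> 'v::real_vector"
  assumes left: "\<And>y. linear (\<lambda>x. \<beta> x y)" and right: "\<And>x. linear (\<beta> x)"
  obtains L where "linear L" "\<And>x y. L (x \<otimes> y) = \<beta> x y"
proof -
  let ?E = "free_extend (\<lambda>(x, y). \<beta> x y)"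
  note lin = linear_free_extend[of "\<lambda>(x, y). \<beta> x y"]
  have "?E r = 0" if "r \<in> span tensor_relations" for r
  proof (rule linear_eq_0_on_span[OF lin _ that])
    show "?E r = 0" if "r \<in> tensor_relations" for r
      using that
      by (elim tensor_relationsE)
        (simp_all add: linear_diff[OF lin] linear_add[OF lin] linear_scale[OF lin]
          linear_add[OF left] linear_scale[OF left] linear_add[OF right] linear_scale[OF right])
  qed
  then have resp: "?E f = ?E g" if "f - g \<in> span tensor_relations" for f g
    using that linear_diff[OF lin, of f g] by simp
  define L where "L t = ?E (rep_tensor t)" for t
  \<comment> \<open>\<open>rep_tensor (abs_tensor f)\<close> differs from \<open>f\<close> by an
    element of the span of the relations, which \<open>resp\<close> allows.\<close>
  have L: "L (abs_tensor f) = ?E f" for f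
    unfolding L_def
    by (rule resp) (simp only: Quotient3_abs_rep[OF Quotient3_tensor] flip: tensor.abs_eq_iff)
  have "linear L"
  proof (rule linearI)
    show "L (s + t) = L s + L t" for s t
      by (induct s rule: tensor.abs_induct, induct t rule: tensor.abs_induct)
        (simp add: plus_tensor.abs_eq L linear_add[OF lin])
    show "L (c *\<^sub>R t) = c *\<^sub>R L t" for c t
      by (induct t rule: tensor.abs_induct) (simp add: scaleR_tensor.abs_eq L linear_scale[OF lin])
  qed
  moreover have "L (x \<otimes> y) = \<beta> x y" for x y
    by (simp add: pure_tensor.abs_eq L)
  ultimately show ?thesis by (rule that)
qed

section \<open>Dual numbers\<close>

text \<open>Hence a class in \<open>dual_number\<close> is determined by its coefficients of degree
  0 and 1, and these are well defined.\<close>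

lemma eps_square_dvd_iff:
  "[:0, 1:] ^ 2 dvd p \<longleftrightarrow> coeff p 0 = 0 \<and> coeff p 1 = 0" for p :: "real poly"
proof
  assume "[:0, 1:] ^ 2 dvd p"
  then obtain q where "p = [:0, 1:] ^ 2 * q" ..
  then show "coeff p 0 = 0 \<and> coeff p 1 = 0" by (simp add: power2_eq_square)
next
  assume *: "coeff p 0 = 0 \<and> coeff p 1 = 0"
  obtain a b q where p: "p = pCons a (pCons b q)" by (metis pCons_cases)
  have "p = [:0, 1:] ^ 2 * q" using * by (simp add: p power2_eq_square)
  then show "[:0, 1:] ^ 2 dvd p" by (rule dvdI)
qed

lift_definition dual_fst :: "dual_number \<Rightarrow> real" is "\<lambda>p. coeff p 0"
  by (simp add: eps_square_dvd_iff)

lift_definition dual_snd :: "dual_number \<Rightarrow> real" is "\<lambda>p. coeff p 1"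
  by (simp add: eps_square_dvd_iff)

lemma linear_dual_fst: "linear dual_fst" and linear_dual_snd: "linear dual_snd"
  by (rule linearI; transfer; simp)+

lemma dual_fst_snd_basis [simp]:
  "dual_fst 1 = 1" "dual_snd 1 = 0" "dual_fst dual_eps = 0" "dual_snd dual_eps = 1"
  by (transfer; simp)+

lemma dual_number_decomp: "p = dual_fst p *\<^sub>R 1 + dual_snd p *\<^sub>R dual_eps"
  by transfer (simp add: eps_square_dvd_iff)

text \<open>Such sums form a subspace that contains every pure tensor, since \<open>1\<close> and
  \<open>dual_eps\<close> span the dual numbers.\<close>

lemma tensor_dual_exhaust:
  fixes t :: "('a::real_vector, dual_number) tensor"
  obtains x y where "t = x \<otimes> 1 + y \<otimes> dual_eps"
proof -
  let ?S = "{x \<otimes> 1 + y \<otimes> dual_eps | x y :: 'a. True}"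
  have "subspace ?S"
  proof (rule subspaceI)
    show "0 \<in> ?S"
      by (auto intro!: exI[of _ 0])
    show "s + t \<in> ?S" if "s \<in> ?S" "t \<in> ?S" for s t
    proof -
      from that obtain x y x' y' where
        "s = x \<otimes> 1 + y \<otimes> dual_eps" "t = x' \<otimes> 1 + y' \<otimes> dual_eps" by blast
      then have "s + t = (x + x') \<otimes> 1 + (y + y') \<otimes> dual_eps"
        by (simp add: pure_tensor_bilinear)
      then show ?thesis by blast
    qed
    show "c *\<^sub>R t \<in> ?S" if t: "t \<in> ?S" for c t
    proof -
      from t obtain x y where "t = x \<otimes> 1 + y \<otimes> dual_eps" by blast
      then have "c *\<^sub>R t = (c *\<^sub>R x) \<otimes> 1 + (c *\<^sub>R y) \<otimes> dual_eps"
        by (simp add: pure_tensor_bilinear scaleR_add_right)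
      then show ?thesis by blast
    qed
  qed
  moreover have "x \<otimes> p \<in> ?S" for x :: 'a and p
  proof -
    have "x \<otimes> p = x \<otimes> (dual_fst p *\<^sub>R 1 + dual_snd p *\<^sub>R dual_eps)"
      by (simp flip: dual_number_decomp)
    also have "\<dots> = (dual_fst p *\<^sub>R x) \<otimes> 1 + (dual_snd p *\<^sub>R x) \<otimes> dual_eps"
      by (simp add: pure_tensor_bilinear)
    finally show ?thesis by blast
  qed
  ultimately have "span {x \<otimes> p | (x :: 'a) (p :: dual_number). True} \<subseteq> ?S"
    by (intro span_minimal) auto
  then show ?thesis using that unfolding span_pure_tensors by blast
qed

text \<open>Once the product of the two \<open>dual_eps\<close> terms vanishes, what remains is the
  semidirect product of a Lie algebra with its adjoint module.\<close>

lemma lie_bracket_tensor_dual: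
  "lie_bracket (x \<otimes> 1 + y \<otimes> dual_eps) (x' \<otimes> 1 + y' \<otimes> dual_eps) =
     lie_bracket x x' \<otimes> 1 + (lie_bracket x y' + lie_bracket y x') \<otimes> dual_eps"
  using dual_eps_square
  by (simp add: lie_bracket_add_left lie_bracket_add_right lie_bracket_pure_tensor
      pure_tensor_bilinear power2_eq_square)

section \<open>Coordinates on the matrix algebras\<close>

text \<open>The matrix is \<open>a (-F) + b (H/2) + c E\<close>, so that \<open>a\<close>,
  \<open>b\<close>, \<open>c\<close> match the coefficients of \<open>V_plus\<close>,
  \<open>D_field\<close>, \<open>Y_minus_half\<close>.\<close>

lift_definition sl2_of :: "real \<Rightarrow> real \<Rightarrow> real \<Rightarrow> sl2" is
  "\<lambda>a b c. vector [vector [b / 2, c], vector [- a, - b / 2]]"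
  by (simp add: trace_def sum_2)

lemma sl2_of_exhaust: obtains a b c where "A = sl2_of a b c"
proof -
  have "\<exists>a b c. A = sl2_of a b c"
  proof (transfer)
    fix A :: "real^2^2"
    assume "trace A = 0"
    then have "A = vector [vector [(2 * A$1$1) / 2, A$1$2], vector [- (- A$2$1), - (2 * A$1$1) / 2]]"
      by (simp add: vec_eq_iff forall_2 trace_def sum_2)
    then show "\<exists>a b c. A = vector [vector [b / 2, c], vector [- a, - b / 2]]" by blast
  qed
  then show ?thesis using that by blast
qed

lemma sl2_of_add: "sl2_of a b c + sl2_of a' b' c' = sl2_of (a + a') (b + b') (c + c')"
  by transfer (simp add: vec_eq_iff forall_2 field_simps)

lemma sl2_of_0: "sl2_of 0 0 0 = 0"
  by transfer (simp add: vec_eq_iff forall_2)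

lemma lie_bracket_sl2_of:
  "lie_bracket (sl2_of a b c) (sl2_of a' b' c') =
     sl2_of (a * b' - b * a') (2 * (a * c' - c * a')) (b * c' - c * b')"
  by transfer
    (simp add: matrix_commutator_def matrix_matrix_mult_def vec_eq_iff forall_2 sum_2 field_simps)

lift_definition sl2_coord :: "sl2 \<Rightarrow> real^3" is
  "\<lambda>A. vector [- A$2$1, 2 * A$1$1, A$1$2]" .

lemma sl2_coord_of [simp]: "sl2_coord (sl2_of a b c) = vector [a, b, c]"
  by transfer (simp add: vec_eq_iff forall_3)

lemma linear_sl2_coord: "linear sl2_coord"
  by (rule linearI; transfer; simp add: vec_eq_iff forall_3)

text \<open>
  The matrix of the adjoint action of \<open>sl2_of a b c\<close> in the coordinates
  \<open>(b/2, (a - c)/2, (a + c)/2)\<close>, in which minus the determinant of \<open>sl2_of a b c\<close> is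
  \<open>x\<^sub>1\<^sup>2 + x\<^sub>2\<^sup>2 - x\<^sub>3\<^sup>2\<close>.
\<close>

lift_definition so21_of :: "real \<Rightarrow> real \<Rightarrow> real \<Rightarrow> so21" is
  "\<lambda>a b c. vector [vector [0, - (a + c), a - c], vector [a + c, 0, - b], vector [a - c, - b, 0]]"
  by (simp add: transpose_def minkowski_def matrix_matrix_mult_def vec_eq_iff forall_3 sum_3)

lemma so21_of_exhaust: obtains a b c where "A = so21_of a b c"
proof -
  have "\<exists>a b c. A = so21_of a b c"
  proof (transfer)
    fix A :: "real^3^3"
    assume "transpose A ** minkowski + minkowski ** A = 0"
    then have "A$1$1 = 0" "A$2$2 = 0" "A$3$3 = 0" "A$1$2 + A$2$1 = 0" "A$3$1 = A$1$3"
      "A$3$2 = A$2$3"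
      by (simp_all add: transpose_def minkowski_def matrix_matrix_mult_def vec_eq_iff forall_3 sum_3)
    \<comment> \<open>Solves \<open>a - c = A$1$3\<close> and
      \<open>a + c = - A$1$2\<close>.\<close>
    then have "A = (let a = (A$1$3 - A$1$2) / 2; b = - A$2$3; c = - (A$1$2 + A$1$3) / 2 in
        vector [vector [0, - (a + c), a - c], vector [a + c, 0, - b], vector [a - c, - b, 0]])"
      by (simp add: vec_eq_iff forall_3 Let_def field_simps)
    then show "\<exists>a b c. A = vector
        [vector [0, - (a + c), a - c], vector [a + c, 0, - b], vector [a - c, - b, 0]]"
      unfolding Let_def by blast
  qed
  then show ?thesis using that by blast
qed

lemma so21_of_add: "so21_of a b c + so21_of a' b' c' = so21_of (a + a') (b + b') (c + c')"
  by transfer (simp add: vec_eq_iff forall_3)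

lemma so21_of_scaleR: "k *\<^sub>R so21_of a b c = so21_of (k * a) (k * b) (k * c)"
  by transfer (simp add: vec_eq_iff forall_3 algebra_simps)

lemma so21_of_0: "so21_of 0 0 0 = 0"
  by transfer (simp add: vec_eq_iff forall_3)

text \<open>The structure constants agree with \<open>lie_bracket_sl2_of\<close> and with the first
  three coordinates of \<open>lie_bracket_alt_of\<close>.\<close>

lemma lie_bracket_so21_of:
  "lie_bracket (so21_of a b c) (so21_of a' b' c') =
     so21_of (a * b' - b * a') (2 * (a * c' - c * a')) (b * c' - c * b')"
  by transfer
    (simp add: matrix_commutator_def matrix_matrix_mult_def vec_eq_iff forall_3 sum_3 algebra_simps)

lemma so21_act_of:
  "so21_act (so21_of a b c) v = vector
     [- (a + c) * v$2 + (a - c) * v$3, (a + c) * v$1 - b * v$3, (a - c) * v$1 - b * v$2]"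
  by transfer (simp add: matrix_vector_mult_def vec_eq_iff forall_3 sum_3)

lift_definition so21_coord :: "so21 \<Rightarrow> real^3" is
  "\<lambda>A. vector [(A$1$3 - A$1$2) / 2, - A$2$3, - (A$1$2 + A$1$3) / 2]" .

lemma so21_coord_of [simp]: "so21_coord (so21_of a b c) = vector [a, b, c]"
  by transfer (simp add: vec_eq_iff forall_3)

section \<open>Coordinates on the Poincare algebra\<close>

definition poincare3_of :: "so21 \<Rightarrow> real^3 \<Rightarrow> poincare3" where
  "poincare3_of A v = Abs_poincare3 (A, v)"

lemma Rep_poincare3_of [simp]: "Rep_poincare3 (poincare3_of A v) = (A, v)"
  by (simp add: poincare3_of_def Abs_poincare3_inverse)

lemma poincare3_of_exhaust:
  obtains a b c v where "P = poincare3_of (so21_of a b c) v"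
proof -
  obtain A v where "Rep_poincare3 P = (A, v)" by fastforce
  then have "P = poincare3_of A v" by (simp flip: Rep_poincare3_inject)
  then show ?thesis using that by (metis so21_of_exhaust)
qed

lemma poincare3_of_add:
  "poincare3_of A v + poincare3_of B w = poincare3_of (A + B) (v + w)"
  by (simp add: plus_poincare3.rep_eq flip: Rep_poincare3_inject)

lemma poincare3_of_scaleR: "k *\<^sub>R poincare3_of A v = poincare3_of (k *\<^sub>R A) (k *\<^sub>R v)"
  by (simp add: scaleR_poincare3.rep_eq flip: Rep_poincare3_inject)

lemma poincare3_of_0: "poincare3_of 0 0 = 0"
  by (simp add: zero_poincare3.rep_eq zero_prod_def flip: Rep_poincare3_inject)

lemma lie_bracket_poincare3_of:
  "lie_bracket (poincare3_of A v) (poincare3_of B w) =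
     poincare3_of (lie_bracket A B) (so21_act A w - so21_act B v)"
  by (simp add: lie_bracket_poincare3.rep_eq flip: Rep_poincare3_inject)

section \<open>The two isomorphisms\<close>

lemma alt_iso_sl2_dual: "\<exists>f :: alt \<Rightarrow> (sl2, dual_number) tensor. lie_isomorphism f"
proof -
  \<comment> \<open>The factor 2 comes from \<open>-F\<close> times \<epsilon> being 2
    \<open>X_one\<close>.\<close>
  define \<beta> where "\<beta> A p = (let u = sl2_coord A; k = dual_fst p; l = dual_snd p in
    alt_of (k * u$1) (k * u$2) (k * u$3) (2 * l * u$1) (l * u$2) (l * u$3))" for A p
  note lin = linear_add[OF linear_sl2_coord] linear_scale[OF linear_sl2_coord]
    linear_add[OF linear_dual_fst] linear_scale[OF linear_dual_fst]
    linear_add[OF linear_dual_snd] linear_scale[OF linear_dual_snd]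
  have "linear (\<lambda>A. \<beta> A p)" "linear (\<beta> A)" for A p
    by (rule linearI; simp add: \<beta>_def Let_def lin alt_of_add alt_of_scaleR alt_of_eq_iff
        algebra_simps)+
  then obtain L :: "(sl2, dual_number) tensor \<Rightarrow> alt"
    where L: "linear L" and pure: "\<And>A p. L (A \<otimes> p) = \<beta> A p"
    by (rule tensor_universal) blast
  have L_of: "L (sl2_of a b c \<otimes> 1 + sl2_of d e f \<otimes> dual_eps) = alt_of a b c (2 * d) e f"
    for a b c d e f
    by (simp add: linear_add[OF L] pure \<beta>_def alt_of_add)
  have exh: "\<exists>a b c d e f. t = sl2_of a b c \<otimes> 1 + sl2_of d e f \<otimes> dual_eps" for t
    by (metis tensor_dual_exhaust sl2_of_exhaust)
  have "lie_isomorphism L"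
  proof (rule lie_isomorphismI[OF L])
    fix s t :: "(sl2, dual_number) tensor" and y :: alt
    obtain a b c d e f where s: "s = sl2_of a b c \<otimes> 1 + sl2_of d e f \<otimes> dual_eps"
      using exh by blast
    obtain a' b' c' d' e' f' where t: "t = sl2_of a' b' c' \<otimes> 1 + sl2_of d' e' f' \<otimes> dual_eps"
      using exh by blast
    show "s = 0" if "L s = 0"
      using that unfolding s L_of alt_of_eq_0_iff
      by (simp add: sl2_of_0)
    obtain a b c d e f where "y = alt_of a b c d e f" by (rule alt_of_exhaust)
    \<comment> \<open>Halving \<open>d\<close> undoes the factor 2 at \<open>X_one\<close>.\<close>
    then have "L (sl2_of a b c \<otimes> 1 + sl2_of (d / 2) e f \<otimes> dual_eps) = y" by (simp add: L_of)
    then show "\<exists>x. L x = y" ..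
    show "L (lie_bracket s t) = lie_bracket (L s) (L t)"
      unfolding s t lie_bracket_tensor_dual lie_bracket_sl2_of sl2_of_add L_of lie_bracket_alt_of
        alt_of_eq_iff
      by (simp add: algebra_simps)
  qed
  then show ?thesis by (blast intro: lie_isomorphism_inv)
qed

lemma alt_iso_poincare3: "\<exists>g :: alt \<Rightarrow> poincare3. lie_isomorphism g"
proof -
  \<comment> \<open>In the coordinates chosen for \<open>so21_of\<close>, \<open>v\<close> stands
    for the \<open>sl2\<close> element with parameters \<open>v$2 + v$3\<close>,
    \<open>2 * v$1\<close>, \<open>v$3 - v$2\<close>. Its image is a quarter of the one under the
    tensor map; rescaling the abelian ideal preserves brackets.\<close>
  define L where "L P = (let (A, v) = Rep_poincare3 P; u = so21_coord A in
    alt_of (u$1) (u$2) (u$3) ((v$2 + v$3) / 2) (v$1 / 2) ((v$3 - v$2) / 4))" for P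
  have L_of: "L (poincare3_of (so21_of a b c) v) =
      alt_of a b c ((v$2 + v$3) / 2) (v$1 / 2) ((v$3 - v$2) / 4)" for a b c v
    by (simp add: L_def)
  have "lie_isomorphism L"
  proof (rule lie_isomorphismI)
    fix P Q :: poincare3 and k :: real and y :: alt
    obtain a b c v where P: "P = poincare3_of (so21_of a b c) v" by (rule poincare3_of_exhaust)
    obtain a' b' c' w where Q: "Q = poincare3_of (so21_of a' b' c') w"
      by (rule poincare3_of_exhaust)
    show "P = 0" if "L P = 0"
    proof -
      have "a = 0" "b = 0" "c = 0" "v = 0"
        using that unfolding P L_of alt_of_eq_0_iff by (auto simp: vec_eq_iff forall_3)
      then show ?thesis by (simp add: P so21_of_0 poincare3_of_0)
    qed
    obtain a b c d e f where "y = alt_of a b c d e f" by (rule alt_of_exhaust)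
    \<comment> \<open>The vector solves \<open>v$1 / 2 = e\<close>,
      \<open>(v$2 + v$3) / 2 = d\<close>, \<open>(v$3 - v$2) / 4 = f\<close>.\<close>
    then have "L (poincare3_of (so21_of a b c) (vector [2 * e, d - 2 * f, d + 2 * f])) = y"
      by (simp add: L_of)
    then show "\<exists>x. L x = y" ..
    show "L (lie_bracket P Q) = lie_bracket (L P) (L Q)"
      unfolding P Q lie_bracket_poincare3_of lie_bracket_so21_of so21_act_of L_of
        lie_bracket_alt_of alt_of_eq_iff
      by (simp add: field_simps)
  next
    have "L (P + Q) = L P + L Q" "L (k *\<^sub>R P) = k *\<^sub>R L P" for P Q k
    proof -
      obtain a b c v where P: "P = poincare3_of (so21_of a b c) v" by (rule poincare3_of_exhaust)
      obtain a' b' c' w where Q: "Q = poincare3_of (so21_of a' b' c') w"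
        by (rule poincare3_of_exhaust)
      show "L (P + Q) = L P + L Q"
        unfolding P Q poincare3_of_add so21_of_add L_of alt_of_add alt_of_eq_iff
        by (simp add: field_simps)
      show "L (k *\<^sub>R P) = k *\<^sub>R L P"
        unfolding P poincare3_of_scaleR so21_of_scaleR L_of alt_of_scaleR alt_of_eq_iff
        by (simp add: field_simps)
    qed
    then show "linear L" by (rule linearI)
  qed
  then show ?thesis by (blast intro: lie_isomorphism_inv)
qed

theorem proposition2p1:
  shows "(\<exists>f :: alt \<Rightarrow> (sl2, dual_number) tensor. lie_isomorphism f)
       \<and> (\<exists>g :: alt \<Rightarrow> poincare3. lie_isomorphism g)"
  using alt_iso_sl2_dual alt_iso_poincare3 ..

end
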